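(* Let $\mathbb{F}$ be an algebraically closed field. Let $$L(\lambda)=\begin{bmatrix} M(\lambda) & K_2(\lambda)^T \\ K_1(\lambda) & 0 \end{bmatrix}$$ be a block full rank pencil over $\mathbb{F}$ with $\deg(L(\lambda))=1$ and let $N_1(\lambda)$ and $N_2(\lambda)$ be rational bases dual to $K_1(\lambda)$ and $K_2(\lambda)$, respectively. If, for $i=1,2$, $\operatorname{rev}_1K_i(\lambda)$ has full row rank at zero, and there exists an integer $t_i$ such that $\operatorname{rev}_{t_i}N_i(\lambda)$ has full row rank at zero, then $L(\lambda)$ is a linearization with empty state matrix of the rational matrix $G(\lambda)=N_2(\lambda)M(\lambda)N_1(\lambda)^T$ at $\infty$ of grade $1+t_1+t_2$.
   Context: For a rational matrix $R(\lambda)$ and an integer $g$, $\operatorname{rev}_gR(\lambda):=\lambda^gR(1/\lambda)$. A pencil is a polynomial matrix of degree at most $1$. A block full rank pencil is a pencil $L(\lambda)=\begin{bmatrix} M(\lambda) & K_2(\lambda)^T \\ K_1(\lambda) & 0 \end{bmatrix}$ where $K_1(\lambda)$ and $K_2(\lambda)$ are pencils with full row normal rank (full row rank over $\mathbb{F}(\lambda)$). The cases when $K_1$ or $K_2$ is empty (only one block row or only one block column) are included. A rational matrix $H(\lambda)\in\mathbb{F}(\lambda)^{p\times m}$, $p<m$, is a rational basis if it has full row normal rank. Two rational bases $H(\lambda)\in\mathbb{F}(\lambda)^{p\times m}$ and $N(\lambda)\in\mathbb{F}(\lambda)^{q\times m}$ are dual if $p+q=m$ and $H(\lambda)N(\lambda)^T=0$.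 If $K_1$ (resp. $K_2$) is empty, $N_1$ (resp. $N_2$) is any square rational matrix with nonzero determinant (for instance the identity) whose size is the number of columns (resp. rows) of $M$, and the condition on $\operatorname{rev}_1K_i$ is vacuous. A rational matrix $R(\lambda)$ with $p$ rows has full row rank at zero if no entry of $R$ has a pole at $0$ and $\operatorname{rank}R(0)=p$. A square rational matrix is regular at $0$ if no entry has a pole at $0$ and its determinant is nonzero at $0$. A pencil $L(\lambda)\in\mathbb{F}[\lambda]^{q\times r}$ of degree $\ell$ is a linearization with empty state matrix of a rational matrix $G(\lambda)\in\mathbb{F}(\lambda)^{p\times m}$ at $\infty$ of grade $g$ ($g$ an integer) if there exist integers $s_1,s_2\ge0$ with $s_1-s_2=q-p=r-m$ and rational matrices $Q_1,Q_2$ regular at $0$, of sizes $p+s_1$ and $m+s_1$, such that $Q_1(\lambda)\,\mathrm{diag}(\operatorname{rev}_gG(\lambda),I_{s_1})\,Q_2(\lambda)=\mathrm{diag}(\operatorname{rev}_\ell L(\lambda),I_{s_2})$. *)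

theory Defs
  imports
    "HOL-Computational_Algebra.Polynomial_Factorial"
    "Jordan_Normal_Form.Char_Poly"
    "Jordan_Normal_Form.DL_Rank"
begin

text \<open>
  The field of rational functions \<open>F(\<lambda>)\<close> is \<^typ>\<open>'a poly fract\<close>; polynomial and rational matrices are
  \<^typ>\<open>'a poly mat\<close> and \<^typ>\<open>'a poly fract mat\<close>. Matrices may have zero rows or columns.
\<close>

subsection \<open>Rational functions\<close>

definition rat_var :: "'a::field poly fract" where
  "rat_var = to_fract [:0, 1:]"

definition poly_at_inverse_var :: "'a::field poly \<Rightarrow> 'a poly fract" where
  "poly_at_inverse_var p = poly (map_poly (\<lambda>c. to_fract [:c:]) p) (inverse rat_var)"

interpretation const_fract: map_poly_inj_idom_hom "\<lambda>c::'a::field. to_fract [:c:]"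
proof
  show "to_fract [:x + y:] = to_fract [:x:] + to_fract [:y:]" for x y :: 'a
    by (metis add_pCons add_0 to_fract_add)
  show "to_fract [:x * y:] = to_fract [:x:] * to_fract [:y:]" for x y :: 'a
    by (metis mult_to_poly to_fract_mult)
  show "x = 0" if "to_fract [:x:] = 0" for x :: 'a
    using that by simp
qed (simp_all add: one_poly_def [symmetric] pCons_one)

lemma rat_var_nonzero: "rat_var \<noteq> (0 :: 'a::field poly fract)"
  by (simp add: rat_var_def)

lemma poly_map_const_rat_var:
  "poly (map_poly (\<lambda>c. to_fract [:c:]) p) rat_var = to_fract (p :: 'a::field poly)"
proof (induction p)
  case (pCons a p)
  have "to_fract (pCons a p) = to_fract [:a:] + rat_var * to_fract p"
    unfolding rat_var_def to_fract_mult [symmetric] to_fract_add [symmetric] by simp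
  with pCons show ?case by (simp add: map_poly_pCons)
qed simp

lemma poly_at_inverse_var_mult:
  "poly_at_inverse_var (p * q) = poly_at_inverse_var p * poly_at_inverse_var q"
  by (simp add: poly_at_inverse_var_def const_fract.hom_mult)

lemma poly_at_inverse_var_eq_0_iff: "poly_at_inverse_var p = 0 \<longleftrightarrow> p = (0 :: 'a::field poly)"
proof
  assume *: "poly_at_inverse_var p = 0"
  let ?P = "map_poly (\<lambda>c. to_fract [:c:]) p :: 'a poly fract poly"
  have "reflect_poly ?P = map_poly (\<lambda>c. to_fract [:c:]) (reflect_poly p)"
    by (rule poly_eqI) (simp add: coeff_reflect_poly coeff_map_poly degree_map_poly)
  hence "to_fract (reflect_poly p) = poly (reflect_poly ?P) rat_var"
    by (simp add: poly_map_const_rat_var)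
  also have "\<dots> = 0"
    using * by (simp add: poly_reflect_poly_nz rat_var_nonzero poly_at_inverse_var_def)
  finally show "p = 0" by simp
qed (simp add: poly_at_inverse_var_def)

text \<open>The substitution \<open>f(\<lambda>) \<mapsto> f(1/\<lambda>)\<close>.\<close>

definition at_inverse_var :: "'a::field poly fract \<Rightarrow> 'a poly fract" where
  "at_inverse_var f =
     (THE h. \<exists>p q. f = Fract p q \<and> q \<noteq> 0 \<and> h = poly_at_inverse_var p / poly_at_inverse_var q)"

lemma at_inverse_var_Fract:
  assumes "q \<noteq> 0"
  shows "at_inverse_var (Fract p q) = poly_at_inverse_var p / poly_at_inverse_var q"
  unfolding at_inverse_var_def
proof (rule the_equality)
  fix h
  assume "\<exists>p' q'. Fract p q = Fract p' q' \<and> q' \<noteq> 0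
            \<and> h = poly_at_inverse_var p' / poly_at_inverse_var q'"
  then obtain p' q' where *: "Fract p q = Fract p' q'" "q' \<noteq> 0"
      "h = poly_at_inverse_var p' / poly_at_inverse_var q'"
    by blast
  with assms have "p * q' = p' * q" by (simp add: eq_fract)
  hence "poly_at_inverse_var p * poly_at_inverse_var q'
       = poly_at_inverse_var p' * poly_at_inverse_var q"
    by (metis poly_at_inverse_var_mult)
  with * assms show "h = poly_at_inverse_var p / poly_at_inverse_var q"
    by (simp add: poly_at_inverse_var_eq_0_iff frac_eq_eq)
qed (use assms in blast)

definition no_pole_at :: "'a::field \<Rightarrow> 'a poly fract \<Rightarrow> bool" where
  "no_pole_at a f \<longleftrightarrow> (\<exists>p q. f = Fract p q \<and> poly q a \<noteq> 0)"

text \<open>The value \<open>f(a)\<close>; meaningful only if \<open>f\<close> has no pole at \<open>a\<close>.\<close>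

definition rat_eval :: "'a::field \<Rightarrow> 'a poly fract \<Rightarrow> 'a" where
  "rat_eval a f = (THE v. \<exists>p q. f = Fract p q \<and> poly q a \<noteq> 0 \<and> v = poly p a / poly q a)"

lemma rat_eval_Fract:
  assumes "poly q a \<noteq> 0"
  shows "rat_eval a (Fract p q) = poly p a / poly q a"
  unfolding rat_eval_def
proof (rule the_equality)
  fix v assume "\<exists>p' q'. Fract p q = Fract p' q' \<and> poly q' a \<noteq> 0 \<and> v = poly p' a / poly q' a"
  then obtain p' q' where *: "Fract p q = Fract p' q'" "poly q' a \<noteq> 0" "v = poly p' a / poly q' a"
    by blast
  moreover from assms * have "q \<noteq> 0" "q' \<noteq> 0" by auto
  ultimately have "p * q' = p' * q" by (simp add: eq_fract)
  hence "poly p a * poly q' a = poly p' a * poly q a" by (metis poly_mult)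
  with * assms show "v = poly p a / poly q a" by (simp add: frac_eq_eq)
qed (use assms in blast)

subsection \<open>Polynomial and rational matrices\<close>

definition rat_mat :: "'a::field poly mat \<Rightarrow> 'a poly fract mat" where
  "rat_mat A = map_mat to_fract A"

text \<open>The zero polynomial counts as having degree 0, so zero and empty matrices have degree 0.\<close>

definition mat_degree :: "'a::field poly mat \<Rightarrow> nat" where
  "mat_degree A = Max (insert 0 (degree ` elements_mat A))"

definition pencil :: "'a::field poly mat \<Rightarrow> bool" where
  "pencil A \<longleftrightarrow> mat_degree A \<le> 1"

definition rev_mat :: "int \<Rightarrow> 'a::field poly fract mat \<Rightarrow> 'a poly fract mat" where
  "rev_mat g R = map_mat (\<lambda>f. rat_var powi g * at_inverse_var f) R"

definition full_row_rank :: "'b::field mat \<Rightarrow> bool" where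
  "full_row_rank A \<longleftrightarrow> vec_space.rank (dim_row A) A = dim_row A"

definition full_row_rank_at_zero :: "'a::field poly fract mat \<Rightarrow> bool" where
  "full_row_rank_at_zero R \<longleftrightarrow>
     (\<forall>f \<in> elements_mat R. no_pole_at 0 f) \<and> full_row_rank (map_mat (rat_eval 0) R)"

definition regular_at_zero :: "'a::field poly fract mat \<Rightarrow> bool" where
  "regular_at_zero Q \<longleftrightarrow>
     square_mat Q \<and> (\<forall>f \<in> elements_mat Q. no_pole_at 0 f) \<and> rat_eval 0 (det Q) \<noteq> 0"

lemma full_row_rank_empty:
  assumes "dim_row A = 0"
  shows "full_row_rank A"
proof -
  have "A = 0\<^sub>m 0 (dim_col A)" using assms by (intro eq_matI) auto
  thus ?thesis unfolding full_row_rank_def using assms vec_space.rank_0I by metis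
qed

lemma full_row_rank_at_zero_empty: "dim_row R = 0 \<Longrightarrow> full_row_rank_at_zero R"
  by (auto simp: full_row_rank_at_zero_def full_row_rank_empty)

subsection \<open>Dual rational bases\<close>

definition rational_basis :: "'a::field poly fract mat \<Rightarrow> bool" where
  "rational_basis H \<longleftrightarrow> dim_row H < dim_col H \<and> full_row_rank H"

definition dual_rational_bases :: "'a::field poly fract mat \<Rightarrow> 'a poly fract mat \<Rightarrow> bool" where
  "dual_rational_bases H N \<longleftrightarrow> rational_basis H \<and> rational_basis N \<and>
     dim_col H = dim_col N \<and> dim_row H + dim_row N = dim_col H \<and>
     H * transpose_mat N = 0\<^sub>m (dim_row H) (dim_row N)"

text \<open>
  An empty \<open>K\<close> is represented by a matrix with no rows; its number of columns is still that of the
  block above (or transposed, beside) it. By convention its duals are the nonsingular square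
  matrices of that size.
\<close>

definition dual_basis_of_block :: "'a::field poly mat \<Rightarrow> 'a poly fract mat \<Rightarrow> bool" where
  "dual_basis_of_block K N \<longleftrightarrow>
     (if dim_row K = 0 then N \<in> carrier_mat (dim_col K) (dim_col K) \<and> det N \<noteq> 0
      else dual_rational_bases (rat_mat K) N)"

subsection \<open>Block full rank pencils\<close>

definition block_matrix :: "'a::field poly mat \<Rightarrow> 'a poly mat \<Rightarrow> 'a poly mat \<Rightarrow> 'a poly mat" where
  "block_matrix M K\<^sub>1 K\<^sub>2 =
     four_block_mat M (transpose_mat K\<^sub>2) K\<^sub>1 (0\<^sub>m (dim_row K\<^sub>1) (dim_row K\<^sub>2))"

definition block_full_rank_pencil :: "'a::field poly mat \<Rightarrow> 'a poly mat \<Rightarrow> 'a poly mat \<Rightarrow> bool" where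
  "block_full_rank_pencil M K\<^sub>1 K\<^sub>2 \<longleftrightarrow>
     dim_col K\<^sub>1 = dim_col M \<and> dim_col K\<^sub>2 = dim_row M \<and>
     pencil (block_matrix M K\<^sub>1 K\<^sub>2) \<and>
     full_row_rank (rat_mat K\<^sub>1) \<and> full_row_rank (rat_mat K\<^sub>2)"

subsection \<open>Linearizations at infinity\<close>

definition linearization_empty_state_at_infinity ::
    "'a::field poly mat \<Rightarrow> 'a poly fract mat \<Rightarrow> int \<Rightarrow> bool" where
  "linearization_empty_state_at_infinity L G g \<longleftrightarrow> pencil L \<and>
     (\<exists>s\<^sub>1 s\<^sub>2 :: nat. \<exists>Q\<^sub>1 Q\<^sub>2.
        int s\<^sub>1 - int s\<^sub>2 = int (dim_row L) - int (dim_row G) \<and>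
        int s\<^sub>1 - int s\<^sub>2 = int (dim_col L) - int (dim_col G) \<and>
        Q\<^sub>1 \<in> carrier_mat (dim_row G + s\<^sub>1) (dim_row G + s\<^sub>1) \<and> regular_at_zero Q\<^sub>1 \<and>
        Q\<^sub>2 \<in> carrier_mat (dim_col G + s\<^sub>1) (dim_col G + s\<^sub>1) \<and> regular_at_zero Q\<^sub>2 \<and>
        Q\<^sub>1 * diag_block_mat [rev_mat g G, 1\<^sub>m s\<^sub>1] * Q\<^sub>2
          = diag_block_mat [rev_mat (int (mat_degree L)) (rat_mat L), 1\<^sub>m s\<^sub>2])"

end

theory Submission
  imports Defs
begin

text \<open>
  Put \<open>X = rev\<^sub>1 M\<close>, \<open>A\<^sub>i = rev\<^sub>1 K\<^sub>i\<close>, \<open>B\<^sub>i = rev\<^bsub>t\<^sub>i\<^esub> N\<^sub>i\<close> and work over the local ring of rational functions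
  without a pole at 0. Full row rank at zero gives right inverses over this ring, and from
  \<open>A\<^sub>i B\<^sub>i\<^sup>T = 0\<close> these yield \<open>C\<^sub>i\<close>, \<open>E\<^sub>i\<close> over the ring with \<open>B\<^sub>i\<^sup>T C\<^sub>i + E\<^sub>i A\<^sub>i = I\<close>. Inserting this on both
  sides of \<open>X\<close> shows that \<open>rev\<^sub>1 L\<close>, with blocks \<open>X\<close>, \<open>A\<^sub>2\<^sup>T\<close>, \<open>A\<^sub>1\<close> and 0, is \<open>diag (B\<^sub>2 X B\<^sub>1\<^sup>T, I)\<close> multiplied
  on both sides by block matrices with inverses over the ring; and \<open>B\<^sub>2 X B\<^sub>1\<^sup>T\<close> is \<open>rev\<^sub>g G\<close> for
  \<open>g = 1 + t\<^sub>1 + t\<^sub>2\<close>.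
\<close>

section \<open>Right inverses over a field\<close>

text \<open>When the rank equals the number of rows, the columns contain a basis of the whole space.
  Every unit vector therefore has a preimage, and these preimages are the columns of
  \<open>E\<close>.\<close>

lemma (in vec_space) right_inverse_of_full_rank:
  assumes A: "A \<in> carrier_mat n nc" and rank: "rank A = n"
  shows "\<exists>E \<in> carrier_mat nc n. A * E = 1\<^sub>m n"
proof -
  have cols: "set (cols A) \<subseteq> carrier_vec n" using cols_dim A by blast
  obtain S where S: "maximal S (\<lambda>T. T \<subseteq> set (cols A) \<and> lin_indpt T)"
    using maximal_exists_superset[of "set (cols A)" "\<lambda>T. T \<subseteq> set (cols A) \<and> lin_indpt T" "{}"]
    by (auto simp: finite_lin_indpt2)
  hence S_props: "S \<subseteq> set (cols A)" "lin_indpt S" by (auto simp: maximal_def)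
  have "card S = n" using rank_card_indpt[OF A S] rank by simp
  hence "basis S"
    using S_props cols by (intro dim_li_is_basis) (auto intro: finite_subset simp: dim_is_n)
  hence "carrier_vec n \<subseteq> span (set (cols A))"
    using span_is_monotone[OF S_props(1)] by (auto simp: basis_def)
  hence surj: "\<exists>x \<in> carrier_vec nc. A *\<^sub>v x = y" if "y \<in> carrier_vec n" for y
    using col_space_eq[OF A] that A unfolding col_space_def by auto
  \<comment> \<open>No bound on \<open>i\<close> is needed for the choice: for \<open>i >= n\<close>
    the vector \<open>unit_vec n i\<close> is zero, but still lies in the carrier.\<close>
  define x where "x i = (SOME x. x \<in> carrier_vec nc \<and> A *\<^sub>v x = unit_vec n i)" for i
  have x: "x i \<in> carrier_vec nc \<and> A *\<^sub>v x i = unit_vec n i" for i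
    unfolding x_def by (rule someI_ex) (use surj[of "unit_vec n i"] in auto)
  define E where "E = mat_of_cols nc (map x [0..<n])"
  have E: "E \<in> carrier_mat nc n" using mat_of_cols_carrier(1)[of nc "map x [0..<n]"] by (simp add: E_def)
  have "A * E = 1\<^sub>m n"
  proof (rule eq_matI)
    fix i j assume ij: "i < dim_row (1\<^sub>m n)" "j < dim_col (1\<^sub>m n)"
    have "col E j = x j" using ij x[of j] by (simp add: E_def)
    hence "(A * E) $$ (i, j) = (A *\<^sub>v x j) $ i" using ij A E by simp
    thus "(A * E) $$ (i, j) = 1\<^sub>m n $$ (i, j)" using ij x[of j] by auto
  qed (use A E in auto)
  thus ?thesis using E by blast
qed

section \<open>The local ring of rational functions without a pole at a point\<close>

lemma no_pole_at_to_fract [simp]: "no_pole_at a (to_fract p)"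
  unfolding no_pole_at_def by (rule exI[of _ p], rule exI[of _ 1]) (simp add: to_fract_def)

lemma no_pole_at_0 [simp]: "no_pole_at a 0"
  and no_pole_at_1 [simp]: "no_pole_at a 1"
  using no_pole_at_to_fract[of a 0] no_pole_at_to_fract[of a 1] by simp_all

lemma rat_eval_to_fract [simp]: "rat_eval a (to_fract p) = poly p a"
  by (simp add: to_fract_def rat_eval_Fract)

lemma rat_eval_0 [simp]: "rat_eval a 0 = 0"
  and rat_eval_1 [simp]: "rat_eval a 1 = 1"
  using rat_eval_to_fract[of a 0] rat_eval_to_fract[of a 1] by simp_all

lemma no_pole_atE:
  assumes "no_pole_at a f"
  obtains p q where "f = Fract p q" "poly q a \<noteq> 0" "q \<noteq> 0"
  using assms unfolding no_pole_at_def by fastforce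

text \<open>A product of denominators that do not vanish at \<open>a\<close> does not vanish there
  either. So these functions form a ring, on which \<open>rat_eval a\<close> is a ring
  homomorphism.\<close>

lemma
  assumes "no_pole_at a f" "no_pole_at a g"
  shows no_pole_at_add [simp]: "no_pole_at a (f + g)"
    and rat_eval_add: "rat_eval a (f + g) = rat_eval a f + rat_eval a g"
    and no_pole_at_mult [simp]: "no_pole_at a (f * g)"
    and rat_eval_mult: "rat_eval a (f * g) = rat_eval a f * rat_eval a g"
proof -
  obtain p q where f: "f = Fract p q" "poly q a \<noteq> 0" "q \<noteq> 0" using assms(1) by (rule no_pole_atE)
  obtain r s where g: "g = Fract r s" "poly s a \<noteq> 0" "s \<noteq> 0" using assms(2) by (rule no_pole_atE)
  have sum: "f + g = Fract (p * s + r * q) (q * s)" and prod: "f * g = Fract (p * r) (q * s)"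
    using f g by simp_all
  have qs: "poly (q * s) a \<noteq> 0" using f g by simp
  show "no_pole_at a (f + g)" "no_pole_at a (f * g)"
    unfolding sum prod no_pole_at_def using qs by blast+
  show "rat_eval a (f + g) = rat_eval a f + rat_eval a g"
    unfolding sum rat_eval_Fract[OF qs] unfolding f(1) g(1) rat_eval_Fract[OF f(2)] rat_eval_Fract[OF g(2)]
    using f(2) g(2) by (simp add: field_simps)
  show "rat_eval a (f * g) = rat_eval a f * rat_eval a g"
    unfolding prod rat_eval_Fract[OF qs] unfolding f(1) g(1) rat_eval_Fract[OF f(2)] rat_eval_Fract[OF g(2)]
    by simp
qed

lemma no_pole_at_uminus [simp]: "no_pole_at a f \<Longrightarrow> no_pole_at a (- f)"
  and rat_eval_uminus: "no_pole_at a f \<Longrightarrow> rat_eval a (- f) = - rat_eval a f"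
  using no_pole_at_mult[of a "to_fract (- 1)" f] rat_eval_mult[of a "to_fract (- 1)" f]
    no_pole_at_to_fract[of a "- 1"] rat_eval_to_fract[of a "- 1"]
  by (simp_all del: no_pole_at_mult no_pole_at_to_fract rat_eval_to_fract)

lemma no_pole_at_minus [simp]: "no_pole_at a f \<Longrightarrow> no_pole_at a g \<Longrightarrow> no_pole_at a (f - g)"
  using no_pole_at_add[of a f "- g"] by simp

text \<open>A nonzero value at \<open>a\<close> turns the numerator into an admissible denominator:
  such functions are the units of the local ring.\<close>

lemma no_pole_at_inverse:
  assumes "no_pole_at a f" "rat_eval a f \<noteq> 0"
  shows "no_pole_at a (inverse f)"
proof -
  obtain p q where f: "f = Fract p q" "poly q a \<noteq> 0" using assms(1) by (rule no_pole_atE)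
  hence "poly p a \<noteq> 0" using assms(2) by (simp add: rat_eval_Fract)
  thus ?thesis using f unfolding no_pole_at_def by (auto simp: inverse_fract)
qed

lemma no_pole_at_sum [simp]: "(\<And>i. i \<in> I \<Longrightarrow> no_pole_at a (f i)) \<Longrightarrow> no_pole_at a (sum f I)"
  and rat_eval_sum: "(\<And>i. i \<in> I \<Longrightarrow> no_pole_at a (f i)) \<Longrightarrow>
    rat_eval a (sum f I) = (\<Sum>i\<in>I. rat_eval a (f i))"
  by (induction I rule: infinite_finite_induct) (simp_all add: rat_eval_add)

lemma no_pole_at_prod [simp]: "(\<And>i. i \<in> I \<Longrightarrow> no_pole_at a (f i)) \<Longrightarrow> no_pole_at a (prod f I)"
  and rat_eval_prod: "(\<And>i. i \<in> I \<Longrightarrow> no_pole_at a (f i)) \<Longrightarrow>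
    rat_eval a (prod f I) = (\<Prod>i\<in>I. rat_eval a (f i))"
  by (induction I rule: infinite_finite_induct) (simp_all add: rat_eval_mult)

section \<open>Matrices over the local ring: evaluation, determinants, inverses\<close>

text \<open>Names the entrywise condition shared by \<open>full_row_rank_at_zero\<close> and
  \<open>regular_at_zero\<close>: the matrix has its entries in the local ring at
  \<open>a\<close>.\<close>

definition no_poles_at :: "'a::field \<Rightarrow> 'a poly fract mat \<Rightarrow> bool" where
  "no_poles_at a A \<longleftrightarrow> (\<forall>f \<in> elements_mat A. no_pole_at a f)"

lemma no_poles_at_iff:
  "no_poles_at a A \<longleftrightarrow> (\<forall>i < dim_row A. \<forall>j < dim_col A. no_pole_at a (A $$ (i, j)))"
  unfolding no_poles_at_def elements_mat_def by auto

lemma no_poles_at_four_block: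
  assumes "A \<in> carrier_mat r1 c1" "B \<in> carrier_mat r1 c2"
    "C \<in> carrier_mat r2 c1" "D \<in> carrier_mat r2 c2"
    and "no_poles_at a A" "no_poles_at a B" "no_poles_at a C" "no_poles_at a D"
  shows "no_poles_at a (four_block_mat A B C D)"
  using assms unfolding no_poles_at_iff by (auto simp: four_block_mat_def Let_def)

lemma no_poles_at_zero [simp]: "no_poles_at a (0\<^sub>m r c)"
  and no_poles_at_one [simp]: "no_poles_at a (1\<^sub>m n)"
  and no_poles_at_transpose [simp]: "no_poles_at a (transpose_mat A) = no_poles_at a A"
  and no_poles_at_uminus [simp]: "no_poles_at a A \<Longrightarrow> no_poles_at a (- A)"
  by (auto simp: no_poles_at_iff)

lemma no_poles_at_minus [simp]:
  "no_poles_at a A \<Longrightarrow> no_poles_at a B \<Longrightarrow> dim_row A = dim_row B \<Longrightarrow> dim_col A = dim_col B \<Longrightarrow>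
    no_poles_at a (A - B)"
  by (auto simp: no_poles_at_iff)

lemma no_poles_at_mult [simp]:
  "no_poles_at a A \<Longrightarrow> no_poles_at a B \<Longrightarrow> dim_col A = dim_row B \<Longrightarrow> no_poles_at a (A * B)"
  by (auto simp: no_poles_at_iff scalar_prod_def intro!: no_pole_at_sum no_pole_at_mult)

lemma rat_eval_mat_mult:
  assumes "no_poles_at a A" "no_poles_at a B" "dim_col A = dim_row B"
  shows "map_mat (rat_eval a) (A * B) = map_mat (rat_eval a) A * map_mat (rat_eval a) B"
proof (rule eq_matI)
  fix i j
  assume "i < dim_row (map_mat (rat_eval a) A * map_mat (rat_eval a) B)"
    and "j < dim_col (map_mat (rat_eval a) A * map_mat (rat_eval a) B)"
  thus "map_mat (rat_eval a) (A * B) $$ (i, j)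
      = (map_mat (rat_eval a) A * map_mat (rat_eval a) B) $$ (i, j)"
    using assms
    by (simp add: no_poles_at_iff scalar_prod_def, subst rat_eval_sum)
       (auto simp: rat_eval_mult intro!: no_pole_at_mult)
qed simp_all

text \<open>The determinant is a polynomial in the entries. The Leibniz sum is followed term by term
  because \<open>rat_eval a\<close> respects sums and products only on the local ring and is no
  homomorphism of the field of rational functions.\<close>

lemma
  assumes A: "A \<in> carrier_mat n n" and "no_poles_at a A"
  shows no_pole_at_det: "no_pole_at a (det A)"
    and rat_eval_det: "rat_eval a (det A) = det (map_mat (rat_eval a) A)"
proof -
  have entry: "no_pole_at a (A $$ (i, j))" if "i < n" "j < n" for i j
    using assms that by (auto simp: no_poles_at_iff)
  have perm: "p i < n" if "p permutes {0..<n}" "i \<in> {0..<n}" for p i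
    using that permutes_in_image[of p "{0..<n}" i] by simp
  \<comment> \<open>\<open>signof p\<close> is a rational function inside \<open>rat_eval\<close>
    and an element of the base field on the right of the equation.\<close>
  have sign: "no_pole_at a (signof p)" "rat_eval a (signof p) = signof p" for p
    by (simp_all add: sign_def rat_eval_uminus)
  have prod: "no_pole_at a (\<Prod>i = 0..<n. A $$ (i, p i))"
    "rat_eval a (\<Prod>i = 0..<n. A $$ (i, p i)) = (\<Prod>i = 0..<n. rat_eval a (A $$ (i, p i)))"
    if "p permutes {0..<n}" for p
    using perm[OF that] entry by (auto intro!: no_pole_at_prod rat_eval_prod)
  have summand: "no_pole_at a (signof p * (\<Prod>i = 0..<n. A $$ (i, p i)))"
    if "p permutes {0..<n}" for p
    by (rule no_pole_at_mult[OF sign(1) prod(1)[OF that]])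
  show "no_pole_at a (det A)"
    unfolding det_def'[OF A] by (rule no_pole_at_sum) (use summand in simp)
  have A': "map_mat (rat_eval a) A \<in> carrier_mat n n" using A by simp
  have "rat_eval a (det A)
      = (\<Sum>p | p permutes {0..<n}. rat_eval a (signof p * (\<Prod>i = 0..<n. A $$ (i, p i))))"
    unfolding det_def'[OF A] by (rule rat_eval_sum) (use summand in simp)
  also have "\<dots> = det (map_mat (rat_eval a) A)"
    unfolding det_def'[OF A']
  proof (rule sum.cong[OF refl])
    fix p assume p: "p \<in> {p. p permutes {0..<n}}"
    hence "rat_eval a (signof p * (\<Prod>i = 0..<n. A $$ (i, p i)))
        = signof p * (\<Prod>i = 0..<n. rat_eval a (A $$ (i, p i)))"
      using rat_eval_mult[OF sign(1) prod(1)] sign(2) prod(2) by simp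
    thus "rat_eval a (signof p * (\<Prod>i = 0..<n. A $$ (i, p i)))
        = signof p * (\<Prod>i = 0..<n. map_mat (rat_eval a) A $$ (i, p i))"
      using perm p A by simp
  qed
  finally show "rat_eval a (det A) = det (map_mat (rat_eval a) A)" .
qed

text \<open>The adjugate formula stays inside the local ring: cofactors are signed determinants of
  submatrices, and \<open>det W\<close> is a unit there.\<close>

lemma inverse_without_poles:
  assumes W: "W \<in> carrier_mat n n" and np: "no_poles_at a W" and det: "rat_eval a (det W) \<noteq> 0"
  shows "\<exists>V \<in> carrier_mat n n. no_poles_at a V \<and> W * V = 1\<^sub>m n"
proof
  let ?V = "inverse (det W) \<cdot>\<^sub>m adj_mat W"
  show V: "?V \<in> carrier_mat n n" using adj_mat(1)[OF W] by simp
  have "det W \<noteq> 0" using det by auto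
  hence "W * ?V = 1\<^sub>m n"
    using adj_mat(1,2)[OF W] W by (auto simp: mult_smult_distrib intro!: eq_matI)
  moreover have "no_pole_at a (cofactor W i j)" if "i < n" "j < n" for i j
  proof -
    have "mat_delete W i j \<in> carrier_mat (n - 1) (n - 1)"
      using W by (intro mat_delete_carrier)
    moreover have "no_poles_at a (mat_delete W i j)"
      using np W that unfolding no_poles_at_iff mat_delete_def by auto
    ultimately have "no_pole_at a (det (mat_delete W i j))" by (rule no_pole_at_det)
    moreover have "no_pole_at a ((- 1) ^ (i + j))"
      by (cases "even (i + j)") simp_all
    ultimately show ?thesis unfolding cofactor_def by (rule no_pole_at_mult[rotated])
  qed
  hence "no_poles_at a ?V"
    using W det no_pole_at_inverse[OF no_pole_at_det[OF W np] det]
    by (auto simp: no_poles_at_iff adj_mat_def)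
  ultimately show "no_poles_at a ?V \<and> W * ?V = 1\<^sub>m n" by blast
qed

text \<open>Evaluating \<open>det Q * det R = 1\<close> at 0 shows that both values are nonzero.
  Regularity of a block matrix can thus be proved by exhibiting an inverse without poles, with no
  determinant computed.\<close>

lemma regular_at_zero_if_inverse:
  assumes Q: "Q \<in> carrier_mat n n" "no_poles_at 0 Q"
    and R: "R \<in> carrier_mat n n" "no_poles_at 0 R" and inv: "Q * R = 1\<^sub>m n"
  shows "regular_at_zero Q" and "regular_at_zero R"
proof -
  have "det Q * det R = 1" using inv det_mult[OF Q(1) R(1)] by simp
  hence "rat_eval 0 (det Q) * rat_eval 0 (det R) = 1"
    using no_pole_at_det[OF Q] no_pole_at_det[OF R] by (simp flip: rat_eval_mult)
  thus "regular_at_zero Q" "regular_at_zero R"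
    using Q R unfolding regular_at_zero_def no_poles_at_def by auto
qed

section \<open>Right inverses and completion over the local ring\<close>

lemma no_poles_at_const: "no_poles_at a (map_mat (\<lambda>c. to_fract [:c:]) E)"
  by (simp add: no_poles_at_iff)

text \<open>Here and in the similar laws below, the side conditions are equations between
  dimensions, which simplification can solve without knowing carrier sizes.\<close>

lemma mult_assoc_dim:
  fixes A B C :: "'b::semiring_0 mat"
  shows "dim_col A = dim_row B \<Longrightarrow> dim_col B = dim_row C \<Longrightarrow> A * B * C = A * (B * C)"
  by (rule assoc_mult_mat) auto

text \<open>A right inverse of the value of \<open>A\<close> at 0 is lifted to a constant matrix
  \<open>E\<close>. Then \<open>A * E\<close> is the identity at 0, so its determinant is a unit and
  it is invertible over the local ring.\<close>

lemma right_inverse_without_poles: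
  assumes A: "A \<in> carrier_mat p n" and full: "full_row_rank_at_zero A"
  shows "\<exists>E \<in> carrier_mat n p. no_poles_at 0 E \<and> A * E = 1\<^sub>m p"
proof -
  have np: "no_poles_at 0 A" using full by (simp add: full_row_rank_at_zero_def no_poles_at_def)
  have A0: "map_mat (rat_eval 0) A \<in> carrier_mat p n" using A by simp
  obtain E\<^sub>0 where E0: "E\<^sub>0 \<in> carrier_mat n p" "map_mat (rat_eval 0) A * E\<^sub>0 = 1\<^sub>m p"
    using vec_space.right_inverse_of_full_rank[OF A0] full A
    by (auto simp: full_row_rank_at_zero_def full_row_rank_def)
  define E where "E = map_mat (\<lambda>c. to_fract [:c:]) E\<^sub>0"
  have E: "E \<in> carrier_mat n p" "no_poles_at 0 E" "map_mat (rat_eval 0) E = E\<^sub>0"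
    using E0(1) by (auto simp: E_def no_poles_at_const intro!: eq_matI)
  have AE: "A * E \<in> carrier_mat p p" "no_poles_at 0 (A * E)" using A E np by auto
  have "rat_eval 0 (det (A * E)) = 1"
    using rat_eval_det[OF AE] rat_eval_mat_mult[OF np E(2)] A E E0 by simp
  then obtain V where V: "V \<in> carrier_mat p p" "no_poles_at 0 V" "A * E * V = 1\<^sub>m p"
    using inverse_without_poles[OF AE] by auto
  \<comment> \<open>The constant \<open>E\<close> inverts \<open>A\<close> only at 0; the factor
    \<open>V\<close> corrects this to an exact right inverse.\<close>
  show ?thesis
    using V A E by (intro bexI[of _ "E * V"]) (auto simp: mult_assoc_dim)
qed

lemma mult_add_distrib_dim:
  fixes A B C :: "'b::semiring_0 mat"
  shows "dim_col A = dim_row B \<Longrightarrow> dim_row B = dim_row C \<Longrightarrow> dim_col B = dim_col C \<Longrightarrow>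
    A * (B + C) = A * B + A * C"
  and add_mult_distrib_dim:
  "dim_col A = dim_row C \<Longrightarrow> dim_row A = dim_row B \<Longrightarrow> dim_col A = dim_col B \<Longrightarrow>
    (A + B) * C = A * C + B * C"
  by (rule mult_add_distrib_mat add_mult_distrib_mat; auto)+

lemma add_assoc_dim:
  fixes A B C :: "'b::comm_monoid_add mat"
  shows "dim_row A = dim_row B \<Longrightarrow> dim_col A = dim_col B \<Longrightarrow>
    dim_row B = dim_row C \<Longrightarrow> dim_col B = dim_col C \<Longrightarrow> A + B + C = A + (B + C)"
  and add_commute_dim:
  "dim_row A = dim_row B \<Longrightarrow> dim_col A = dim_col B \<Longrightarrow> A + B = B + A"
  and add_left_commute_dim:
  "dim_row A = dim_row B \<Longrightarrow> dim_col A = dim_col B \<Longrightarrow>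
    dim_row B = dim_row C \<Longrightarrow> dim_col B = dim_col C \<Longrightarrow> A + (B + C) = B + (A + C)"
  by (auto intro!: eq_matI simp: ac_simps)

text \<open>A block row is a four-block matrix whose lower blocks have no rows, a block column one
  whose right blocks have no columns. The formula is thus a case of four-block
  multiplication.\<close>

lemma mult_append_cols_rows:
  fixes A B C D :: "'b::semiring_0 mat"
  assumes "A \<in> carrier_mat r c" "B \<in> carrier_mat r d" "C \<in> carrier_mat c k" "D \<in> carrier_mat d k"
  shows "four_block_mat A B (0\<^sub>m 0 c) (0\<^sub>m 0 d) * four_block_mat C (0\<^sub>m c 0) D (0\<^sub>m d 0)
    = A * C + B * D"
proof -
  have "four_block_mat A B (0\<^sub>m 0 c) (0\<^sub>m 0 d) * four_block_mat C (0\<^sub>m c 0) D (0\<^sub>m d 0)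
      = four_block_mat (A * C + B * D) (0\<^sub>m r 0) (0\<^sub>m 0 k) (0\<^sub>m 0 0)"
    using assms mult_four_block_mat[OF assms(1,2) zero_carrier_mat[of 0] zero_carrier_mat[of 0]
        assms(3) zero_carrier_mat[of _ 0] assms(4) zero_carrier_mat[of _ 0]] by simp
  also have "\<dots> = A * C + B * D" using assms by (intro eq_matI) auto
  finally show ?thesis .
qed

text \<open>Stacking \<open>C\<close> on \<open>A\<close> gives a square matrix because
  \<open>p + q = n\<close>, and \<open>[transpose_mat B, E]\<close> is its right inverse. A right
  inverse of a square matrix is also a left inverse, and the product in that order is the claimed
  sum.\<close>

lemma kernel_completion_without_poles:
  assumes A: "A \<in> carrier_mat p n" "full_row_rank_at_zero A"
    and B: "B \<in> carrier_mat q n" "full_row_rank_at_zero B"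
    and pq: "p + q = n" and AB: "A * transpose_mat B = 0\<^sub>m p q"
  shows "\<exists>C \<in> carrier_mat q n. \<exists>E \<in> carrier_mat n p. no_poles_at 0 C \<and> no_poles_at 0 E \<and>
    transpose_mat B * C + E * A = 1\<^sub>m n"
proof -
  have np: "no_poles_at 0 A" using A by (simp add: full_row_rank_at_zero_def no_poles_at_def)
  obtain E where E: "E \<in> carrier_mat n p" "no_poles_at 0 E" "A * E = 1\<^sub>m p"
    using right_inverse_without_poles[OF A] by auto
  obtain F where F: "F \<in> carrier_mat n q" "no_poles_at 0 F" "B * F = 1\<^sub>m q"
    using right_inverse_without_poles[OF B] by auto
  have FB: "transpose_mat F * transpose_mat B = 1\<^sub>m q"
    using transpose_mult[OF B(1) F(1)] F(3) by simp
  \<comment> \<open>\<open>transpose_mat F\<close> is already a left inverse of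
    \<open>transpose_mat B\<close>. The subtracted term forces \<open>C * E = 0\<close> and does not
    disturb this, since \<open>A * transpose_mat B = 0\<close>.\<close>
  define C where "C = transpose_mat F - transpose_mat F * E * A"
  have C: "C \<in> carrier_mat q n" unfolding C_def using A E F by (intro carrier_matI) auto
  have "no_poles_at 0 C" unfolding C_def using A E F np by (intro no_poles_at_minus) auto
  have "C * transpose_mat B = transpose_mat F * transpose_mat B - transpose_mat F * E * A * transpose_mat B"
    unfolding C_def using A B E F by (intro minus_mult_distrib_mat[of _ q n]) auto
  also have "transpose_mat F * E * A * transpose_mat B = 0\<^sub>m q q"
    using A B E F AB by (simp add: mult_assoc_dim)
  finally have CB: "C * transpose_mat B = 1\<^sub>m q" using FB by auto
  have "C * E = transpose_mat F * E - transpose_mat F * E * A * E"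
    unfolding C_def using A E F by (intro minus_mult_distrib_mat[of _ q n]) auto
  also have "transpose_mat F * E * A * E = transpose_mat F * E"
    using A E F by (simp add: mult_assoc_dim)
  finally have CE: "C * E = 0\<^sub>m q p" using E F by auto
  have BT: "transpose_mat B \<in> carrier_mat n q" using B by simp
  let ?H = "four_block_mat C (0\<^sub>m q 0) A (0\<^sub>m p 0)"
  let ?U = "four_block_mat (transpose_mat B) E (0\<^sub>m 0 q) (0\<^sub>m 0 p)"
  have H: "?H \<in> carrier_mat n n" and U: "?U \<in> carrier_mat n n"
    using A(1) B(1) C E(1) pq by (auto intro!: carrier_matI)
  have "?H * ?U = four_block_mat (1\<^sub>m q) (0\<^sub>m q p) (0\<^sub>m p q) (1\<^sub>m p)"
    using mult_four_block_mat[OF C zero_carrier_mat A(1) zero_carrier_mat BT E(1)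
        zero_carrier_mat zero_carrier_mat] CB CE AB E(3) by simp
  hence "?H * ?U = 1\<^sub>m n" using pq by (simp add: add.commute)
  hence "?U * ?H = 1\<^sub>m n" by (rule mat_mult_left_right_inverse[OF H U])
  hence "transpose_mat B * C + E * A = 1\<^sub>m n"
    using mult_append_cols_rows[OF BT E(1) C A(1)] by simp
  thus ?thesis using C E \<open>no_poles_at 0 C\<close> by blast
qed

section \<open>Equivalence of the block matrix with a block diagonal one\<close>

text \<open>
  The left factor has block rows \<open>[P, R, P B X E]\<close>, \<open>[0, 0, I]\<close> and the right factor, read by block
  rows, is \<open>[C, 0]\<close>, \<open>[S X, I]\<close>, \<open>[A, 0]\<close>; \<open>Y\<^sub>i\<close> and \<open>Z\<^sub>i\<close> are blocks of their inverses. Blocks are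
  stacked by \<open>four_block_mat\<close> with empty third and fourth, or second and fourth, arguments.
\<close>

lemma block_matrix_equivalence:
  fixes X :: "'b::field mat"
  assumes X: "X \<in> carrier_mat n2 n1"
    and A: "A \<in> carrier_mat p1 n1" and C: "C \<in> carrier_mat q1 n1"
    and D: "D \<in> carrier_mat n1 q1" and E: "E \<in> carrier_mat n1 p1"
    and B: "B \<in> carrier_mat q2 n2" and S: "S \<in> carrier_mat p2 n2"
    and P: "P \<in> carrier_mat n2 q2" and R: "R \<in> carrier_mat n2 p2"
    and one1: "D * C + E * A = 1\<^sub>m n1" and one2: "P * B + R * S = 1\<^sub>m n2"
  defines "U\<^sub>1 \<equiv> four_block_mat R (P * (B * X * E)) (0\<^sub>m 0 p2) (0\<^sub>m 0 p1)"
    and "U\<^sub>2 \<equiv> four_block_mat (0\<^sub>m p1 p2) (1\<^sub>m p1) (0\<^sub>m 0 p2) (0\<^sub>m 0 p1)"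
    and "V\<^sub>1 \<equiv> four_block_mat (S * X) (0\<^sub>m p2 0) A (0\<^sub>m p1 0)"
    and "V\<^sub>2 \<equiv> four_block_mat (1\<^sub>m p2) (0\<^sub>m p2 0) (0\<^sub>m p1 p2) (0\<^sub>m p1 0)"
    and "Y\<^sub>1 \<equiv> four_block_mat S (0\<^sub>m p2 0) (0\<^sub>m p1 n2) (0\<^sub>m p1 0)"
    and "Y\<^sub>2 \<equiv> four_block_mat (0\<^sub>m p2 p1) (0\<^sub>m p2 0) (1\<^sub>m p1) (0\<^sub>m p1 0)"
    and "Z\<^sub>1 \<equiv> four_block_mat (0\<^sub>m n1 p2) E (0\<^sub>m 0 p2) (0\<^sub>m 0 p1)"
    and "Z\<^sub>2 \<equiv> four_block_mat (1\<^sub>m p2) (- (S * X * E)) (0\<^sub>m 0 p2) (0\<^sub>m 0 p1)"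
  shows "four_block_mat P U\<^sub>1 (0\<^sub>m p1 q2) U\<^sub>2
       * four_block_mat (B * X * D) (0\<^sub>m q2 (p2 + p1)) (0\<^sub>m (p2 + p1) q1) (1\<^sub>m (p2 + p1))
       * four_block_mat C (0\<^sub>m q1 p2) V\<^sub>1 V\<^sub>2
       = four_block_mat X R A (0\<^sub>m p1 p2)" (is "?thesis1")
    and "four_block_mat P U\<^sub>1 (0\<^sub>m p1 q2) U\<^sub>2
       * four_block_mat B (- (B * X * E)) Y\<^sub>1 Y\<^sub>2 = 1\<^sub>m (n2 + p1)" (is "?thesis2")
    and "four_block_mat D Z\<^sub>1 (- (S * X * D)) Z\<^sub>2
       * four_block_mat C (0\<^sub>m q1 p2) V\<^sub>1 V\<^sub>2 = 1\<^sub>m (n1 + p2)" (is "?thesis3")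
proof -
  note dims = assms(1-9)
  have U: "U\<^sub>1 \<in> carrier_mat n2 (p2 + p1)" "U\<^sub>2 \<in> carrier_mat p1 (p2 + p1)"
    and V: "V\<^sub>1 \<in> carrier_mat (p2 + p1) n1" "V\<^sub>2 \<in> carrier_mat (p2 + p1) p2"
    and Y: "Y\<^sub>1 \<in> carrier_mat (p2 + p1) n2" "Y\<^sub>2 \<in> carrier_mat (p2 + p1) p1"
    and Z: "Z\<^sub>1 \<in> carrier_mat n1 (p2 + p1)" "Z\<^sub>2 \<in> carrier_mat p2 (p2 + p1)"
    unfolding U\<^sub>1_def U\<^sub>2_def V\<^sub>1_def V\<^sub>2_def Y\<^sub>1_def Y\<^sub>2_def Z\<^sub>1_def Z\<^sub>2_def
    using dims by (auto intro!: carrier_matI)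
  note ring = mult_assoc_dim mult_add_distrib_dim add_mult_distrib_dim
  have PBXE: "P * (B * X * E) \<in> carrier_mat n2 p1" and SX: "S * X \<in> carrier_mat p2 n1"
    and SXE: "- (S * X * E) \<in> carrier_mat p2 p1" and PBXD: "P * (B * X * D) \<in> carrier_mat n2 q1"
    and BXE: "- (B * X * E) \<in> carrier_mat q2 p1" and SXD: "- (S * X * D) \<in> carrier_mat p2 q1"
    and BXD: "B * X * D \<in> carrier_mat q2 q1"
    using dims by (auto intro!: carrier_matI)
  note mult_blocks = mult_append_cols_rows[OF R PBXE] mult_append_cols_rows[OF zero_carrier_mat one_carrier_mat]
    mult_append_cols_rows[OF zero_carrier_mat E] mult_append_cols_rows[OF one_carrier_mat SXE]
  have UV: "U\<^sub>1 * V\<^sub>1 = R * (S * X) + P * (B * X * E) * A" "U\<^sub>1 * V\<^sub>2 = R"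
    "U\<^sub>2 * V\<^sub>1 = A" "U\<^sub>2 * V\<^sub>2 = 0\<^sub>m p1 p2"
    unfolding U\<^sub>1_def U\<^sub>2_def V\<^sub>1_def V\<^sub>2_def
      mult_blocks[OF SX A] mult_blocks[OF one_carrier_mat zero_carrier_mat]
    using R A SX PBXE by (simp_all add: right_mult_zero_mat[OF PBXE] left_mult_zero_mat[OF SX])
  have UY: "U\<^sub>1 * Y\<^sub>1 = R * S" "U\<^sub>1 * Y\<^sub>2 = P * (B * X * E)"
    "U\<^sub>2 * Y\<^sub>1 = 0\<^sub>m p1 n2" "U\<^sub>2 * Y\<^sub>2 = 1\<^sub>m p1"
    unfolding U\<^sub>1_def U\<^sub>2_def Y\<^sub>1_def Y\<^sub>2_def mult_blocks[OF S zero_carrier_mat]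
      mult_blocks[OF zero_carrier_mat one_carrier_mat]
    using R S PBXE by (simp_all add: right_mult_zero_mat[OF PBXE] right_mult_one_mat[OF PBXE])
  have ZV: "Z\<^sub>1 * V\<^sub>1 = E * A" "Z\<^sub>1 * V\<^sub>2 = 0\<^sub>m n1 p2"
    "Z\<^sub>2 * V\<^sub>1 = S * X + - (S * X * E) * A" "Z\<^sub>2 * V\<^sub>2 = 1\<^sub>m p2"
    unfolding Z\<^sub>1_def Z\<^sub>2_def V\<^sub>1_def V\<^sub>2_def
      mult_blocks[OF SX A] mult_blocks[OF one_carrier_mat zero_carrier_mat]
    using E A S SX SXE by (simp_all add: left_mult_zero_mat[OF SX] left_mult_one_mat[OF SX])
  \<comment> \<open>The left identity is inserted in front of all of \<open>X\<close>, the right one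
    only in the \<open>P * B\<close> summand: \<open>R * (S * X)\<close> is already a summand of
    \<open>U\<^sub>1 * V\<^sub>1\<close>.\<close>
  have "X = (P * B + R * S) * X" using X one2 by simp
  also have "\<dots> = P * (B * X) + R * (S * X)" using dims by (simp add: ring)
  also have "P * (B * X) = P * (B * (X * (D * C + E * A)))" using X one1 by simp
  also have "\<dots> + R * (S * X) = P * (B * X * D) * C + (R * (S * X) + P * (B * X * E) * A)"
    using dims by (simp add: ring add_assoc_dim add_commute_dim add_left_commute_dim)
  finally have X_eq: "P * (B * X * D) * C + U\<^sub>1 * V\<^sub>1 = X" using UV(1) by simp
  have "four_block_mat P U\<^sub>1 (0\<^sub>m p1 q2) U\<^sub>2
       * four_block_mat (B * X * D) (0\<^sub>m q2 (p2 + p1)) (0\<^sub>m (p2 + p1) q1) (1\<^sub>m (p2 + p1))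
     = four_block_mat (P * (B * X * D)) U\<^sub>1 (0\<^sub>m p1 q1) U\<^sub>2"
    using mult_four_block_mat[OF P U(1) zero_carrier_mat U(2) BXD zero_carrier_mat
        zero_carrier_mat one_carrier_mat] P U PBXD BXD
    by (simp add: left_mult_zero_mat[OF BXD])
  also have "\<dots> * four_block_mat C (0\<^sub>m q1 p2) V\<^sub>1 V\<^sub>2 = four_block_mat X R A (0\<^sub>m p1 p2)"
    using mult_four_block_mat[OF PBXD U(1) zero_carrier_mat U(2) C zero_carrier_mat V]
      C PBXD A R by (simp add: UV(2-4) X_eq right_mult_zero_mat[OF PBXD])
  finally show ?thesis1 .
  \<comment> \<open>This is the upper right block of the product; the other three blocks follow from
    \<open>UY\<close> and \<open>one2\<close>.\<close>
  have "P * (- (B * X * E)) + P * (B * X * E) = 0\<^sub>m n2 p1"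
    using dims by (auto intro!: eq_matI)
  hence "four_block_mat P U\<^sub>1 (0\<^sub>m p1 q2) U\<^sub>2 * four_block_mat B (- (B * X * E)) Y\<^sub>1 Y\<^sub>2
      = four_block_mat (1\<^sub>m n2) (0\<^sub>m n2 p1) (0\<^sub>m p1 n2) (1\<^sub>m p1)"
    using mult_four_block_mat[OF P U(1) zero_carrier_mat U(2) B BXE Y]
    by (simp only: UY one2 left_mult_zero_mat[OF B] left_mult_zero_mat[OF BXE]
        left_add_zero_mat[OF zero_carrier_mat] left_add_zero_mat[OF one_carrier_mat])
  thus ?thesis2 by simp
  \<comment> \<open>The lower left block vanishes because \<open>D * C + E * A\<close> is the
    identity.\<close>
  have "- (S * X * D) * C + (S * X + - (S * X * E) * A) = S * X + - (S * X * (D * C + E * A))"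
    using dims by (auto intro!: eq_matI simp: ring)
  also have "\<dots> = 0\<^sub>m p2 n1" using dims one1 by (auto intro!: eq_matI)
  finally have "four_block_mat D Z\<^sub>1 (- (S * X * D)) Z\<^sub>2 * four_block_mat C (0\<^sub>m q1 p2) V\<^sub>1 V\<^sub>2
      = four_block_mat (1\<^sub>m n1) (0\<^sub>m n1 p2) (0\<^sub>m p2 n1) (1\<^sub>m p2)"
    using mult_four_block_mat[OF D Z(1) SXD Z(2) C zero_carrier_mat V]
    by (simp only: ZV one1 right_mult_zero_mat[OF D] right_mult_zero_mat[OF SXD]
        left_add_zero_mat[OF zero_carrier_mat] left_add_zero_mat[OF one_carrier_mat])
  thus ?thesis3 by simp
qed

text \<open>The transforming factors and their inverses are built from blocks without poles by
  products, negation and stacking, so both factors are regular at 0.\<close>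

lemma block_equivalence_at_zero:
  assumes X: "X \<in> carrier_mat n2 n1"
    and A: "A \<in> carrier_mat p1 n1" and C: "C \<in> carrier_mat q1 n1"
    and D: "D \<in> carrier_mat n1 q1" and E: "E \<in> carrier_mat n1 p1"
    and B: "B \<in> carrier_mat q2 n2" and S: "S \<in> carrier_mat p2 n2"
    and P: "P \<in> carrier_mat n2 q2" and R: "R \<in> carrier_mat n2 p2"
    and one1: "D * C + E * A = 1\<^sub>m n1" and one2: "P * B + R * S = 1\<^sub>m n2"
    and size: "p1 + q1 = n1" "p2 + q2 = n2"
    and np: "no_poles_at 0 X" "no_poles_at 0 A" "no_poles_at 0 C" "no_poles_at 0 D"
      "no_poles_at 0 E" "no_poles_at 0 B" "no_poles_at 0 S" "no_poles_at 0 P" "no_poles_at 0 R"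
  obtains Q\<^sub>1 Q\<^sub>2 where
    "Q\<^sub>1 \<in> carrier_mat (q2 + (p2 + p1)) (q2 + (p2 + p1))" "regular_at_zero Q\<^sub>1"
    "Q\<^sub>2 \<in> carrier_mat (q1 + (p2 + p1)) (q1 + (p2 + p1))" "regular_at_zero Q\<^sub>2"
    "Q\<^sub>1 * four_block_mat (B * X * D) (0\<^sub>m q2 (p2 + p1)) (0\<^sub>m (p2 + p1) q1) (1\<^sub>m (p2 + p1)) * Q\<^sub>2
      = four_block_mat X R A (0\<^sub>m p1 p2)"
proof -
  define U\<^sub>1 where "U\<^sub>1 = four_block_mat R (P * (B * X * E)) (0\<^sub>m 0 p2) (0\<^sub>m 0 p1)"
  define U\<^sub>2 where "U\<^sub>2 = four_block_mat (0\<^sub>m p1 p2) (1\<^sub>m p1) (0\<^sub>m 0 p2) (0\<^sub>m 0 p1 :: 'a poly fract mat)"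
  define V\<^sub>1 where "V\<^sub>1 = four_block_mat (S * X) (0\<^sub>m p2 0) A (0\<^sub>m p1 0)"
  define V\<^sub>2 where "V\<^sub>2 = four_block_mat (1\<^sub>m p2) (0\<^sub>m p2 0) (0\<^sub>m p1 p2) (0\<^sub>m p1 0 :: 'a poly fract mat)"
  define Y\<^sub>1 where "Y\<^sub>1 = four_block_mat S (0\<^sub>m p2 0) (0\<^sub>m p1 n2) (0\<^sub>m p1 0)"
  define Y\<^sub>2 where "Y\<^sub>2 = four_block_mat (0\<^sub>m p2 p1) (0\<^sub>m p2 0) (1\<^sub>m p1) (0\<^sub>m p1 0 :: 'a poly fract mat)"
  define Z\<^sub>1 where "Z\<^sub>1 = four_block_mat (0\<^sub>m n1 p2) E (0\<^sub>m 0 p2) (0\<^sub>m 0 p1)"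
  define Z\<^sub>2 where "Z\<^sub>2 = four_block_mat (1\<^sub>m p2) (- (S * X * E)) (0\<^sub>m 0 p2) (0\<^sub>m 0 p1)"
  note defs = U\<^sub>1_def U\<^sub>2_def V\<^sub>1_def V\<^sub>2_def Y\<^sub>1_def Y\<^sub>2_def Z\<^sub>1_def Z\<^sub>2_def
  note carriers = assms(1-9)
  let ?Q1 = "four_block_mat P U\<^sub>1 (0\<^sub>m p1 q2) U\<^sub>2"
  let ?R1 = "four_block_mat B (- (B * X * E)) Y\<^sub>1 Y\<^sub>2"
  let ?Q2 = "four_block_mat C (0\<^sub>m q1 p2) V\<^sub>1 V\<^sub>2"
  let ?R2 = "four_block_mat D Z\<^sub>1 (- (S * X * D)) Z\<^sub>2"
  have prods: "P * (B * X * E) \<in> carrier_mat n2 p1" "S * X \<in> carrier_mat p2 n1"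
    "- (S * X * E) \<in> carrier_mat p2 p1"
    "- (B * X * E) \<in> carrier_mat q2 p1" "- (S * X * D) \<in> carrier_mat p2 q1"
    using carriers by (auto intro!: carrier_matI)
  have blocks: "U\<^sub>1 \<in> carrier_mat n2 (p2 + p1)" "U\<^sub>2 \<in> carrier_mat p1 (p2 + p1)"
    "V\<^sub>1 \<in> carrier_mat (p2 + p1) n1" "V\<^sub>2 \<in> carrier_mat (p2 + p1) p2"
    "Y\<^sub>1 \<in> carrier_mat (p2 + p1) n2" "Y\<^sub>2 \<in> carrier_mat (p2 + p1) p1"
    "Z\<^sub>1 \<in> carrier_mat n1 (p2 + p1)" "Z\<^sub>2 \<in> carrier_mat p2 (p2 + p1)"
    unfolding defs using carriers by (auto intro!: carrier_matI)
  have np_prods: "no_poles_at 0 (P * (B * X * E))" "no_poles_at 0 (S * X)"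
    "no_poles_at 0 (- (S * X * E))" "no_poles_at 0 (- (B * X * E))" "no_poles_at 0 (- (S * X * D))"
    using carriers np by (auto intro!: no_poles_at_mult no_poles_at_uminus)
  note np_block = no_poles_at_four_block
  have np_blocks: "no_poles_at 0 U\<^sub>1" "no_poles_at 0 U\<^sub>2" "no_poles_at 0 V\<^sub>1" "no_poles_at 0 V\<^sub>2"
    "no_poles_at 0 Y\<^sub>1" "no_poles_at 0 Y\<^sub>2" "no_poles_at 0 Z\<^sub>1" "no_poles_at 0 Z\<^sub>2"
    unfolding defs
    by (rule np_block[OF R prods(1) zero_carrier_mat zero_carrier_mat]
      np_block[OF zero_carrier_mat one_carrier_mat zero_carrier_mat zero_carrier_mat]
      np_block[OF prods(2) zero_carrier_mat A zero_carrier_mat]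
      np_block[OF one_carrier_mat zero_carrier_mat zero_carrier_mat zero_carrier_mat]
      np_block[OF S zero_carrier_mat zero_carrier_mat zero_carrier_mat]
      np_block[OF zero_carrier_mat zero_carrier_mat one_carrier_mat zero_carrier_mat]
      np_block[OF zero_carrier_mat E zero_carrier_mat zero_carrier_mat]
      np_block[OF one_carrier_mat prods(3) zero_carrier_mat zero_carrier_mat]
      np np_prods no_poles_at_zero no_poles_at_one)+
  \<comment> \<open>The outer and inner block sizes agree, so the factors are square.\<close>
  have sizes: "n2 + p1 = q2 + (p2 + p1)" "n1 + p2 = q1 + (p2 + p1)" using size by auto
  have Q1: "?Q1 \<in> carrier_mat (q2 + (p2 + p1)) (q2 + (p2 + p1))"
    and R1: "?R1 \<in> carrier_mat (q2 + (p2 + p1)) (q2 + (p2 + p1))"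
    and Q2: "?Q2 \<in> carrier_mat (q1 + (p2 + p1)) (q1 + (p2 + p1))"
    and R2: "?R2 \<in> carrier_mat (q1 + (p2 + p1)) (q1 + (p2 + p1))"
    using four_block_carrier_mat[OF P blocks(2)] four_block_carrier_mat[OF B blocks(6)]
      four_block_carrier_mat[OF C blocks(4)] four_block_carrier_mat[OF D blocks(8)]
    unfolding sizes by blast+
  have npQ: "no_poles_at 0 ?Q1" "no_poles_at 0 ?R1" "no_poles_at 0 ?Q2" "no_poles_at 0 ?R2"
    by (rule np_block[OF P blocks(1) zero_carrier_mat blocks(2)] np_block[OF B prods(4) blocks(5,6)]
      np_block[OF C zero_carrier_mat blocks(3,4)] np_block[OF D blocks(7) prods(5) blocks(8)]
      np np_prods np_blocks no_poles_at_zero)+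
  note eqs = block_matrix_equivalence[OF carriers one1 one2, folded defs]
  have "regular_at_zero ?Q1"
    by (rule regular_at_zero_if_inverse(1)[OF Q1 npQ(1) R1 npQ(2)]) (use eqs(2) sizes in simp)
  \<comment> \<open>The available identity is \<open>?R2 * ?Q2 = 1\<close>, so \<open>?Q2\<close>
    takes the second place.\<close>
  moreover have "regular_at_zero ?Q2"
    by (rule regular_at_zero_if_inverse(2)[OF R2 npQ(4) Q2 npQ(3)]) (use eqs(3) sizes in simp)
  ultimately show ?thesis using that Q1 Q2 eqs(1) by blast
qed

section \<open>The substitution of the inverse variable and reversal of matrices\<close>

lemma poly_at_inverse_var_add:
  "poly_at_inverse_var (p + q) = poly_at_inverse_var p + poly_at_inverse_var q"
  by (simp add: poly_at_inverse_var_def const_fract.hom_add)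

lemma at_inverse_var_to_fract: "at_inverse_var (to_fract p) = poly_at_inverse_var p"
  by (simp add: to_fract_def at_inverse_var_Fract) (simp add: poly_at_inverse_var_def)

lemma at_inverse_var_0 [simp]: "at_inverse_var (0 :: 'a::field poly fract) = 0"
  using at_inverse_var_to_fract[of "0 :: 'a poly"] by (simp add: poly_at_inverse_var_def)

text \<open>On polynomials the substitution is an injective ring homomorphism, so denominators stay
  nonzero and it extends to fractions.\<close>

lemma at_inverse_var_add: "at_inverse_var (f + g) = at_inverse_var f + at_inverse_var g"
  and at_inverse_var_mult: "at_inverse_var (f * g) = at_inverse_var f * at_inverse_var g"
proof -
  obtain p q where f: "f = Fract p q" "q \<noteq> 0" by (cases f) auto
  obtain r s where g: "g = Fract r s" "s \<noteq> 0" by (cases g) auto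
  have sum: "f + g = Fract (p * s + r * q) (q * s)" and prod: "f * g = Fract (p * r) (q * s)"
    using f g by simp_all
  have qs: "q * s \<noteq> 0" using f g by simp
  show "at_inverse_var (f + g) = at_inverse_var f + at_inverse_var g"
    unfolding sum at_inverse_var_Fract[OF qs]
    unfolding f(1) g(1) at_inverse_var_Fract[OF f(2)] at_inverse_var_Fract[OF g(2)]
    using f(2) g(2)
    by (simp add: poly_at_inverse_var_add poly_at_inverse_var_mult poly_at_inverse_var_eq_0_iff
        field_simps)
  show "at_inverse_var (f * g) = at_inverse_var f * at_inverse_var g"
    unfolding prod at_inverse_var_Fract[OF qs]
    unfolding f(1) g(1) at_inverse_var_Fract[OF f(2)] at_inverse_var_Fract[OF g(2)]
    by (simp add: poly_at_inverse_var_mult)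
qed

lemma at_inverse_var_sum: "at_inverse_var (sum f I) = (\<Sum>i\<in>I. at_inverse_var (f i))"
  by (induction I rule: infinite_finite_induct) (simp_all add: at_inverse_var_add)

text \<open>Grades add because powers of the variable do; negative grades are allowed since
  \<open>rat_var\<close> is nonzero.\<close>

lemma rev_mat_mult:
  assumes "dim_col A = dim_row B"
  shows "rev_mat (g + h) (A * B) = rev_mat g A * rev_mat h B"
  using assms
  by (intro eq_matI)
     (auto simp: rev_mat_def scalar_prod_def at_inverse_var_sum at_inverse_var_mult sum_distrib_left
       power_int_add rat_var_nonzero mult_ac intro!: sum.cong)

lemma rev_mat_dims [simp]:
  "dim_row (rev_mat g A) = dim_row A" "dim_col (rev_mat g A) = dim_col A"
  "dim_row (rat_mat K) = dim_row K" "dim_col (rat_mat K) = dim_col K"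
  by (simp_all add: rev_mat_def rat_mat_def)

lemma rev_mat_transpose: "rev_mat g (transpose_mat A) = transpose_mat (rev_mat g A)"
  by (intro eq_matI) (auto simp: rev_mat_def)

lemma rev_mat_zero [simp]: "rev_mat g (0\<^sub>m r c) = 0\<^sub>m r c"
  by (intro eq_matI) (auto simp: rev_mat_def)

lemma rev_block_matrix:
  assumes "dim_col K\<^sub>1 = dim_col M" "dim_col K\<^sub>2 = dim_row M"
  shows "rev_mat g (rat_mat (block_matrix M K\<^sub>1 K\<^sub>2)) =
    four_block_mat (rev_mat g (rat_mat M)) (transpose_mat (rev_mat g (rat_mat K\<^sub>2)))
      (rev_mat g (rat_mat K\<^sub>1)) (0\<^sub>m (dim_row K\<^sub>1) (dim_row K\<^sub>2))"
  using assms
  by (intro eq_matI) (auto simp: rev_mat_def rat_mat_def block_matrix_def)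

text \<open>Reversal with grade 1 swaps the two coefficients of a polynomial of degree at most 1, so
  the result is again a polynomial.\<close>

lemma no_pole_at_zero_rev_linear:
  assumes "degree p \<le> 1"
  shows "no_pole_at 0 (rat_var * at_inverse_var (to_fract p))"
proof -
  obtain b r where p: "p = pCons b r" by (cases p)
  have "degree r = 0" using assms p by (cases "r = 0") auto
  then obtain c where r: "r = [:c:]" by (rule degree_eq_zeroE)
  have "rat_var * at_inverse_var (to_fract p) = rat_var * to_fract [:b:] + to_fract [:c:]"
    by (simp add: p r at_inverse_var_to_fract poly_at_inverse_var_def Polynomial.map_poly_pCons
        distrib_left rat_var_nonzero)
  thus ?thesis by (simp add: rat_var_def)
qed

lemma no_poles_at_zero_rev_pencil:
  assumes "pencil A" shows "no_poles_at 0 (rev_mat 1 (rat_mat A))"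
proof -
  have "degree (A $$ (i, j)) \<le> 1" if "i < dim_row A" "j < dim_col A" for i j
  proof -
    have "finite (insert 0 (degree ` elements_mat A))" by (simp add: elements_mat_def)
    moreover have "A $$ (i, j) \<in> elements_mat A" using that by auto
    ultimately have "degree (A $$ (i, j)) \<le> mat_degree A"
      unfolding mat_degree_def by (intro Max_ge) auto
    thus ?thesis using assms by (simp add: pencil_def)
  qed
  thus ?thesis unfolding no_poles_at_iff
    by (auto simp: rev_mat_def rat_mat_def intro!: no_pole_at_zero_rev_linear)
qed

section \<open>Dual bases and their reversals at zero\<close>

text \<open>Merges the convention for empty \<open>K\<close> with genuine duality: without rows in
  \<open>K\<close> the product equation is trivial and \<open>N\<close> is square. Afterwards both
  cases are treated alike.\<close>

lemma dual_basis_of_blockD: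
  assumes "dual_basis_of_block K N"
  shows "dim_col N = dim_col K" "dim_row K + dim_row N = dim_col K"
    "rat_mat K * transpose_mat N = 0\<^sub>m (dim_row K) (dim_row N)"
proof -
  have "dim_col N = dim_col K \<and> dim_row K + dim_row N = dim_col K
      \<and> rat_mat K * transpose_mat N = 0\<^sub>m (dim_row K) (dim_row N)"
  proof (cases "dim_row K = 0")
    case True
    thus ?thesis using assms by (auto simp: dual_basis_of_block_def intro!: eq_matI)
  next
    case False
    thus ?thesis using assms by (auto simp: dual_basis_of_block_def dual_rational_bases_def)
  qed
  thus "dim_col N = dim_col K" "dim_row K + dim_row N = dim_col K"
    "rat_mat K * transpose_mat N = 0\<^sub>m (dim_row K) (dim_row N)" by auto
qed

text \<open>Orthogonality of \<open>K\<close> and \<open>N\<close> survives reversal, with grade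
  \<open>1 + t\<close> for the product, so the kernel completion applies to the reversed
  matrices.\<close>

lemma dual_block_completion_at_zero:
  assumes dual: "dual_basis_of_block K N"
    and K: "full_row_rank_at_zero (rev_mat 1 (rat_mat K))" and N: "full_row_rank_at_zero (rev_mat t N)"
  obtains C E where "C \<in> carrier_mat (dim_row N) (dim_col K)" "E \<in> carrier_mat (dim_col K) (dim_row K)"
    "no_poles_at 0 C" "no_poles_at 0 E"
    "transpose_mat (rev_mat t N) * C + E * rev_mat 1 (rat_mat K) = 1\<^sub>m (dim_col K)"
proof -
  note D = dual_basis_of_blockD[OF dual]
  have "rev_mat 1 (rat_mat K) * transpose_mat (rev_mat t N) = rev_mat (1 + t) (rat_mat K * transpose_mat N)"
    using D(1) by (simp add: rev_mat_mult rev_mat_transpose)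
  hence "rev_mat 1 (rat_mat K) * transpose_mat (rev_mat t N) = 0\<^sub>m (dim_row K) (dim_row N)"
    using D by simp
  hence "\<exists>C \<in> carrier_mat (dim_row N) (dim_col K). \<exists>E \<in> carrier_mat (dim_col K) (dim_row K).
      no_poles_at 0 C \<and> no_poles_at 0 E \<and>
      transpose_mat (rev_mat t N) * C + E * rev_mat 1 (rat_mat K) = 1\<^sub>m (dim_col K)"
    using D K N by (intro kernel_completion_without_poles) (auto intro!: carrier_matI)
  thus ?thesis using that by blast
qed

theorem theorem5p8:
  fixes M K\<^sub>1 K\<^sub>2 :: "'a::alg_closed_field poly mat"
    and N\<^sub>1 N\<^sub>2 :: "'a poly fract mat"
    and t\<^sub>1 t\<^sub>2 :: int
  assumes "block_full_rank_pencil M K\<^sub>1 K\<^sub>2"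
    and "mat_degree (block_matrix M K\<^sub>1 K\<^sub>2) = 1"
    and "dual_basis_of_block K\<^sub>1 N\<^sub>1"
    and "dual_basis_of_block K\<^sub>2 N\<^sub>2"
    and "full_row_rank_at_zero (rev_mat 1 (rat_mat K\<^sub>1))"
    and "full_row_rank_at_zero (rev_mat 1 (rat_mat K\<^sub>2))"
    and "full_row_rank_at_zero (rev_mat t\<^sub>1 N\<^sub>1)"
    and "full_row_rank_at_zero (rev_mat t\<^sub>2 N\<^sub>2)"
  shows "linearization_empty_state_at_infinity (block_matrix M K\<^sub>1 K\<^sub>2)
           (N\<^sub>2 * rat_mat M * transpose_mat N\<^sub>1) (1 + t\<^sub>1 + t\<^sub>2)"
proof -
  let ?L = "block_matrix M K\<^sub>1 K\<^sub>2" and ?G = "N\<^sub>2 * rat_mat M * transpose_mat N\<^sub>1"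
  let ?X = "rev_mat 1 (rat_mat M)"
  let ?A\<^sub>1 = "rev_mat 1 (rat_mat K\<^sub>1)" and ?B\<^sub>1 = "rev_mat t\<^sub>1 N\<^sub>1"
  let ?A\<^sub>2 = "rev_mat 1 (rat_mat K\<^sub>2)" and ?B\<^sub>2 = "rev_mat t\<^sub>2 N\<^sub>2"
  have cols: "dim_col K\<^sub>1 = dim_col M" "dim_col K\<^sub>2 = dim_row M" and pencil: "pencil ?L"
    using assms(1) by (auto simp: block_full_rank_pencil_def)
  note D\<^sub>1 = dual_basis_of_blockD[OF assms(3)] and D\<^sub>2 = dual_basis_of_blockD[OF assms(4)]
  obtain C\<^sub>1 E\<^sub>1 where 1: "C\<^sub>1 \<in> carrier_mat (dim_row N\<^sub>1) (dim_col K\<^sub>1)"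
    "E\<^sub>1 \<in> carrier_mat (dim_col K\<^sub>1) (dim_row K\<^sub>1)" "no_poles_at 0 C\<^sub>1" "no_poles_at 0 E\<^sub>1"
    "transpose_mat ?B\<^sub>1 * C\<^sub>1 + E\<^sub>1 * ?A\<^sub>1 = 1\<^sub>m (dim_col K\<^sub>1)"
    by (rule dual_block_completion_at_zero[OF assms(3,5,7)])
  obtain C\<^sub>2 E\<^sub>2 where 2: "C\<^sub>2 \<in> carrier_mat (dim_row N\<^sub>2) (dim_col K\<^sub>2)"
    "E\<^sub>2 \<in> carrier_mat (dim_col K\<^sub>2) (dim_row K\<^sub>2)" "no_poles_at 0 C\<^sub>2" "no_poles_at 0 E\<^sub>2"
    "transpose_mat ?B\<^sub>2 * C\<^sub>2 + E\<^sub>2 * ?A\<^sub>2 = 1\<^sub>m (dim_col K\<^sub>2)"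
    by (rule dual_block_completion_at_zero[OF assms(4,6,8)])
  have A\<^sub>1: "?A\<^sub>1 \<in> carrier_mat (dim_row K\<^sub>1) (dim_col K\<^sub>1)"
    and B\<^sub>1: "?B\<^sub>1 \<in> carrier_mat (dim_row N\<^sub>1) (dim_col K\<^sub>1)"
    and A\<^sub>2: "?A\<^sub>2 \<in> carrier_mat (dim_row K\<^sub>2) (dim_col K\<^sub>2)"
    and B\<^sub>2: "?B\<^sub>2 \<in> carrier_mat (dim_row N\<^sub>2) (dim_col K\<^sub>2)"
    using D\<^sub>1 D\<^sub>2 by (auto intro!: carrier_matI)
  have np: "no_poles_at 0 ?A\<^sub>1" "no_poles_at 0 ?B\<^sub>1" "no_poles_at 0 ?A\<^sub>2" "no_poles_at 0 ?B\<^sub>2"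
    using assms(5-8) by (auto simp: full_row_rank_at_zero_def no_poles_at_def)
  have rev_L: "rev_mat 1 (rat_mat ?L) =
      four_block_mat ?X (transpose_mat ?A\<^sub>2) ?A\<^sub>1 (0\<^sub>m (dim_row K\<^sub>1) (dim_row K\<^sub>2))"
    using cols by (rule rev_block_matrix)
  \<comment> \<open>\<open>M\<close> inherits the degree bound from the whole pencil, of which it is
    the upper left block.\<close>
  have "no_pole_at 0 (?X $$ (i, j))" if "i < dim_row M" "j < dim_col M" for i j
  proof -
    have "?X $$ (i, j) = rev_mat 1 (rat_mat ?L) $$ (i, j)" using that by (simp add: rev_L)
    thus ?thesis using no_poles_at_zero_rev_pencil[OF pencil] that
      unfolding no_poles_at_iff by (simp add: block_matrix_def)
  qed
  hence np_X: "no_poles_at 0 ?X" by (simp add: no_poles_at_iff)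
  \<comment> \<open>\<open>K\<^sub>2\<close> enters the pencil transposed. Transposing its
    completion identity gives the left-hand identity of the block equivalence, with
    \<open>C\<^sub>2\<close>, \<open>?A\<^sub>2\<close> and \<open>E\<^sub>2\<close> transposed in
    the roles of \<open>P\<close>, \<open>R\<close> and \<open>S\<close>.\<close>
  have "transpose_mat (transpose_mat ?B\<^sub>2 * C\<^sub>2 + E\<^sub>2 * ?A\<^sub>2) = 1\<^sub>m (dim_col K\<^sub>2)"
    using 2(5) by simp
  moreover have "transpose_mat (transpose_mat ?B\<^sub>2 * C\<^sub>2) = transpose_mat C\<^sub>2 * ?B\<^sub>2"
    using transpose_mult[of "transpose_mat ?B\<^sub>2" _ _ C\<^sub>2] B\<^sub>2 2(1) by simp
  moreover have "transpose_mat (E\<^sub>2 * ?A\<^sub>2) = transpose_mat ?A\<^sub>2 * transpose_mat E\<^sub>2"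
    using transpose_mult[OF 2(2) A\<^sub>2] .
  moreover have "transpose_mat (transpose_mat ?B\<^sub>2 * C\<^sub>2 + E\<^sub>2 * ?A\<^sub>2)
      = transpose_mat (transpose_mat ?B\<^sub>2 * C\<^sub>2) + transpose_mat (E\<^sub>2 * ?A\<^sub>2)"
    using A\<^sub>2 B\<^sub>2 2 by (intro transpose_add) auto
  ultimately have one2: "transpose_mat C\<^sub>2 * ?B\<^sub>2 + transpose_mat ?A\<^sub>2 * transpose_mat E\<^sub>2 = 1\<^sub>m (dim_col K\<^sub>2)"
    by simp
  have X: "?X \<in> carrier_mat (dim_col K\<^sub>2) (dim_col K\<^sub>1)" using cols by (intro carrier_matI) auto
  have transposed: "transpose_mat ?B\<^sub>1 \<in> carrier_mat (dim_col K\<^sub>1) (dim_row N\<^sub>1)"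
    "transpose_mat E\<^sub>2 \<in> carrier_mat (dim_row K\<^sub>2) (dim_col K\<^sub>2)"
    "transpose_mat C\<^sub>2 \<in> carrier_mat (dim_col K\<^sub>2) (dim_row N\<^sub>2)"
    "transpose_mat ?A\<^sub>2 \<in> carrier_mat (dim_col K\<^sub>2) (dim_row K\<^sub>2)"
    using B\<^sub>1 2(1,2) A\<^sub>2 by (simp_all only: transpose_carrier_mat)
  have np_transposed: "no_poles_at 0 (transpose_mat ?B\<^sub>1)" "no_poles_at 0 (transpose_mat E\<^sub>2)"
    "no_poles_at 0 (transpose_mat C\<^sub>2)" "no_poles_at 0 (transpose_mat ?A\<^sub>2)"
    using np 2(3,4) by simp_all
  obtain Q\<^sub>1 Q\<^sub>2 where Q:
    "Q\<^sub>1 \<in> carrier_mat (dim_row N\<^sub>2 + (dim_row K\<^sub>2 + dim_row K\<^sub>1)) (dim_row N\<^sub>2 + (dim_row K\<^sub>2 + dim_row K\<^sub>1))"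
    "regular_at_zero Q\<^sub>1"
    "Q\<^sub>2 \<in> carrier_mat (dim_row N\<^sub>1 + (dim_row K\<^sub>2 + dim_row K\<^sub>1)) (dim_row N\<^sub>1 + (dim_row K\<^sub>2 + dim_row K\<^sub>1))"
    "regular_at_zero Q\<^sub>2"
    "Q\<^sub>1 * four_block_mat (?B\<^sub>2 * ?X * transpose_mat ?B\<^sub>1)
        (0\<^sub>m (dim_row N\<^sub>2) (dim_row K\<^sub>2 + dim_row K\<^sub>1)) (0\<^sub>m (dim_row K\<^sub>2 + dim_row K\<^sub>1) (dim_row N\<^sub>1))
        (1\<^sub>m (dim_row K\<^sub>2 + dim_row K\<^sub>1)) * Q\<^sub>2 = rev_mat 1 (rat_mat ?L)"
    unfolding rev_L
    by (rule block_equivalence_at_zero[OF X A\<^sub>1 1(1) transposed(1) 1(2) B\<^sub>2 transposed(2-4)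
          1(5) one2 D\<^sub>1(2) D\<^sub>2(2) np_X np(1) 1(3) np_transposed(1) 1(4) np(4) np_transposed(2-4)])
  \<comment> \<open>The grade is first summed in the order of the three factors of
    \<open>?G\<close>, as \<open>rev_mat_mult\<close> produces it.\<close>
  have "rev_mat (t\<^sub>2 + 1 + t\<^sub>1) ?G = ?B\<^sub>2 * ?X * transpose_mat ?B\<^sub>1"
    using D\<^sub>1(1) D\<^sub>2(1) cols by (simp add: rev_mat_mult rev_mat_transpose)
  hence rev_G: "rev_mat (1 + t\<^sub>1 + t\<^sub>2) ?G = ?B\<^sub>2 * ?X * transpose_mat ?B\<^sub>1"
    by (simp add: ac_simps)
  have diag_G: "diag_block_mat [rev_mat (1 + t\<^sub>1 + t\<^sub>2) ?G, 1\<^sub>m (dim_row K\<^sub>2 + dim_row K\<^sub>1)]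
      = four_block_mat (?B\<^sub>2 * ?X * transpose_mat ?B\<^sub>1)
        (0\<^sub>m (dim_row N\<^sub>2) (dim_row K\<^sub>2 + dim_row K\<^sub>1)) (0\<^sub>m (dim_row K\<^sub>2 + dim_row K\<^sub>1) (dim_row N\<^sub>1))
        (1\<^sub>m (dim_row K\<^sub>2 + dim_row K\<^sub>1))"
    unfolding diag_block_mat.simps(2)[of _ "[_]"] diag_block_mat_singleton Let_def rev_G by simp
  have diag_L: "diag_block_mat [rev_mat 1 (rat_mat ?L), 1\<^sub>m 0] = rev_mat 1 (rat_mat ?L)"
    unfolding diag_block_mat.simps(2)[of _ "[_]"] diag_block_mat_singleton Let_def
    by (intro eq_matI) auto
  have dims: "dim_row ?G = dim_row N\<^sub>2" "dim_col ?G = dim_row N\<^sub>1"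
    "dim_row ?L = dim_row M + dim_row K\<^sub>1" "dim_col ?L = dim_col M + dim_row K\<^sub>2"
    by (simp_all add: block_matrix_def)
  \<comment> \<open>The witnesses are
    \<open>s\<^sub>1 = dim_row K\<^sub>2 + dim_row K\<^sub>1\<close> and
    \<open>s\<^sub>2 = 0\<close>. The size equations follow from
    \<open>dim_row K + dim_row N = dim_col K\<close> for both blocks, and the degree hypothesis
    fixes the grade of the reversed pencil as 1.\<close>
  show ?thesis
    unfolding linearization_empty_state_at_infinity_def assms(2) dims
  proof (intro conjI exI)
    show "int (dim_row K\<^sub>2 + dim_row K\<^sub>1) - int 0
        = int (dim_row M + dim_row K\<^sub>1) - int (dim_row N\<^sub>2)"
      and "int (dim_row K\<^sub>2 + dim_row K\<^sub>1) - int 0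
        = int (dim_col M + dim_row K\<^sub>2) - int (dim_row N\<^sub>1)"
      using D\<^sub>1(2) D\<^sub>2(2) cols by simp_all
    show "Q\<^sub>1 * diag_block_mat [rev_mat (1 + t\<^sub>1 + t\<^sub>2) ?G, 1\<^sub>m (dim_row K\<^sub>2 + dim_row K\<^sub>1)] * Q\<^sub>2
        = diag_block_mat [rev_mat (int 1) (rat_mat ?L), 1\<^sub>m 0]"
      unfolding diag_G using Q(5) diag_L by simp
  qed (fact pencil Q)+
qed

end
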